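(* For all integers $n\ge 3$, \[ \left\lceil \log_2 \left\lceil \log_2 n\right\rceil\right\rceil \le \chi\big(J_\pm(n,3,-2)\big)\le 4\left\lceil \log_2 \left\lceil \log_2 n\right\rceil\right\rceil+6, \] where $J_\pm(n,3,-2)$ is the graph whose vertex set consists of all vectors $v\in\{-1,0,1\}^n$ with exactly $3$ nonzero coordinates, two vertices being adjacent if and only if their standard scalar product equals $-2$.
   Context: $\chi(G)$ denotes the chromatic number of $G$: the minimum number of colors in a coloring of the vertices such that adjacent vertices receive different colors. *)

theory Defs
  imports "Jordan_Normal_Form.Matrix" "Graph_Theory.Pair_Digraph"
begin

(* A simple graph is a symmetric loopless pair digraph (locale pair_graph): each edge {u, v} is
   represented by the two arcs (u, v) and (v, u). *)

definition proper_coloring :: "'a pair_pre_digraph \<Rightarrow> nat \<Rightarrow> ('a \<Rightarrow> nat) \<Rightarrow> bool" where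
  "proper_coloring G k c \<longleftrightarrow>
     (\<forall>v \<in> pverts G. c v < k) \<and> (\<forall>(u, v) \<in> parcs G. c u \<noteq> c v)"

(* The minimum is attained for every pair_graph (see chromatic_number_coloring); on a graph without
   a proper coloring by finitely many colors the value is unspecified. *)

definition chromatic_number :: "'a pair_pre_digraph \<Rightarrow> nat" where
  "chromatic_number G = (LEAST k. \<exists>c. proper_coloring G k c)"

(* The graph J_pm(n, k, t). It is simple unless t = k, where every vertex would carry a loop. *)

definition J_pm_verts :: "nat \<Rightarrow> nat \<Rightarrow> int vec set" where
  "J_pm_verts n k =
     {v \<in> carrier_vec n. (\<forall>i < n. v $ i \<in> {-1, 0, 1}) \<and> card {i. i < n \<and> v $ i \<noteq> 0} = k}"

definition J_pm :: "nat \<Rightarrow> nat \<Rightarrow> int \<Rightarrow> int vec pair_pre_digraph" where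
  "J_pm n k t =
     \<lparr> pverts = J_pm_verts n k,
       parcs = {(u, v). u \<in> J_pm_verts n k \<and> v \<in> J_pm_verts n k \<and> u \<bullet> v = t} \<rparr>"

lemma finite_J_pm_verts: "finite (J_pm_verts n k)"
proof -
  have "J_pm_verts n k \<subseteq> vec_of_list ` {xs. set xs \<subseteq> {-1, 0, 1} \<and> length xs = n}"
  proof
    fix v assume "v \<in> J_pm_verts n k"
    then have v: "dim_vec v = n" "\<forall>i < n. v $ i \<in> {-1, 0, 1}"
      by (auto simp: J_pm_verts_def)
    then have "set (list_of_vec v) \<subseteq> {-1, 0, 1}"
      by (auto simp: in_set_conv_nth list_of_vec_index)
    with v(1) show "v \<in> vec_of_list ` {xs. set xs \<subseteq> {-1, 0, 1} \<and> length xs = n}"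
      by (intro image_eqI[of _ _ "list_of_vec v"]) (auto simp: vec_list)
  qed
  then show ?thesis
    by (rule finite_subset) (simp add: finite_lists_length_eq)
qed

lemma J_pm_self_scalar_prod:
  assumes "v \<in> J_pm_verts n k"
  shows "v \<bullet> v = int k"
proof -
  have v: "dim_vec v = n" "\<And>i. i < n \<Longrightarrow> v $ i \<in> {-1, 0, 1}"
    "card {i. i < n \<and> v $ i \<noteq> 0} = k"
    using assms by (auto simp: J_pm_verts_def)
  have "v \<bullet> v = (\<Sum>i \<in> {0..<n}. if v $ i \<noteq> 0 then 1 else 0)"
    unfolding scalar_prod_def v(1) using v(2) by (intro sum.cong) fastforce+
  also have "\<dots> = int (card ({0..<n} \<inter> {i. v $ i \<noteq> 0}))"
    by (simp add: sum.If_cases flip: Collect_neg_eq)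
  also have "{0..<n} \<inter> {i. v $ i \<noteq> 0} = {i. i < n \<and> v $ i \<noteq> 0}"
    by auto
  finally show ?thesis using v(3) by simp
qed

lemma pair_graph_J_pm:
  assumes "t \<noteq> int k"
  shows "pair_graph (J_pm n k t)"
proof unfold_locales
  show "finite (pverts (J_pm n k t))"
    by (simp add: J_pm_def finite_J_pm_verts)
  show "finite (parcs (J_pm n k t))"
    by (rule finite_subset[of _ "J_pm_verts n k \<times> J_pm_verts n k"])
      (auto simp: J_pm_def finite_J_pm_verts)
  have "u \<bullet> v = v \<bullet> u" if "u \<in> J_pm_verts n k" "v \<in> J_pm_verts n k" for u v
    using that by (intro comm_scalar_prod[of _ n]) (auto simp: J_pm_verts_def)
  then show "symmetric (with_proj (J_pm n k t))"
    by (auto simp: J_pm_def symmetric_def sym_def)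
qed (use assms in \<open>auto simp: J_pm_def J_pm_self_scalar_prod\<close>)

lemma chromatic_number_coloring:
  assumes "pair_graph G"
  shows "\<exists>c. proper_coloring G (chromatic_number G) c"
proof -
  interpret pair_graph G by fact
  obtain c :: "'a \<Rightarrow> nat" and k where c: "inj_on c (pverts G)" "c ` pverts G = {..<k}"
    using finite_imp_inj_to_nat_seg[of "pverts G"] by (auto simp: lessThan_def)
  have "c u \<noteq> c v" if "(u, v) \<in> parcs G" for u v
    using that c(1) no_loops[of "(u, v)"] in_arcsD1[of u v] in_arcsD2[of u v] by (auto simp: inj_on_def)
  with c(2) have "proper_coloring G k c"
    by (auto simp: proper_coloring_def)
  then show ?thesis
    unfolding chromatic_number_def by (intro LeastI[of "\<lambda>k. \<exists>c. proper_coloring G k c" k]) blast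
qed

end

theory Submission
  imports Defs
begin

text \<open>
  Two vertices are adjacent iff their supports share exactly two points and the signs are opposite
  at both. Restricted to the vertices with sign pattern \<open>+ - +\<close>, adjacency is
  the shift relation: \<open>a < b < c\<close> is adjacent to \<open>b < c < d\<close>. A proper
  colouring of the shifted triples by \<open>k\<close> colours yields one of the shifted pairs by
  \<open>2 ^ k\<close> colours and then an injection of the points into a set of size
  \<open>2 ^ 2 ^ k\<close>, whence the lower bound.

  For the upper bound, separate vertices by their majority sign. Adjacent vertices of the same
  majority sign both have exactly one minority coordinate, and each has it at a shared
  point. The vertices whose minority coordinate comes first are therefore independent, likewise
  those where it comes last, and those where it is in the middle form a shift graph, which binary
  expansions colour with \<open>2 t\<close> colours if \<open>n \<le> 2 ^ 2 ^ t\<close>. This gives \<open>2 (2 t + 2)\<close> colours in total.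
\<close>

section \<open>Colouring shift graphs by binary digits\<close>

text \<open>Otherwise every bit of \<open>b\<close> would be a bit of \<open>a\<close>, so
  \<open>and a b = b\<close>, although \<open>and a b\<close> is at most \<open>a\<close>.\<close>

lemma less_imp_bit_differs:
  fixes a b :: nat
  assumes "a < b" "b < 2 ^ m"
  shows "\<exists>i<m. \<not> bit a i \<and> bit b i"
proof (rule ccontr)
  assume none: "\<not> ?thesis"
  have "take_bit m b = b" using assms(2) by (simp add: take_bit_nat_eq_self)
  then have "bit b i \<Longrightarrow> i < m" for i by (metis bit_take_bit_iff)
  with none have "bit b i \<Longrightarrow> bit a i" for i by blast
  then have "and a b = b" by (auto intro!: bit_eqI simp: bit_and_iff)
  moreover have "and a b \<le> a" by (metis and_nat_def nat_int of_nat_0_le_iff AND_upper1 nat_le_iff)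
  ultimately show False using assms(1) by simp
qed

lemma neq_imp_bit_differs:
  fixes x y :: nat
  assumes "x \<noteq> y" "x < 2 ^ m" "y < 2 ^ m"
  shows "\<exists>i<m. bit x i \<noteq> bit y i"
  using assms less_imp_bit_differs[of x y m] less_imp_bit_differs[of y x m]
  by (meson linorder_neqE_nat)

text \<open>A pair is coloured by a bit position at which \<open>a\<close> has 0 and
  \<open>b\<close> has 1. Equal colours on \<open>(a, b)\<close> and \<open>(b, c)\<close> would
  make the same bit of \<open>b\<close> both 1 and 0.\<close>

lemma shift_pairs_coloring:
  assumes "n \<le> 2 ^ m"
  obtains p :: "nat \<Rightarrow> nat \<Rightarrow> nat"
  where "\<And>a b. a < b \<Longrightarrow> b < n \<Longrightarrow> p a b < m"
    and "\<And>a b c. a < b \<Longrightarrow> b < c \<Longrightarrow> c < n \<Longrightarrow> p a b \<noteq> p b c"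
proof -
  have "\<exists>i<m. \<not> bit a i \<and> bit b i" if "a < b" "b < n" for a b
    using that assms by (intro less_imp_bit_differs) auto
  then obtain p where p: "\<And>a b. a < b \<Longrightarrow> b < n \<Longrightarrow> p a b < m \<and> \<not> bit a (p a b) \<and> bit b (p a b)"
    by metis
  show ?thesis
  proof (rule that)
    fix a b c assume "a < b" "b < c" "c < n"
    then show "p a b \<noteq> p b c" using p[of a b] p[of b c] by auto
  qed (use p in auto)
qed

lemma shift_triples_coloring:
  assumes "n \<le> 2 ^ 2 ^ t"
  obtains h :: "nat \<Rightarrow> nat \<Rightarrow> nat \<Rightarrow> nat"
  where "\<And>a b c. a < b \<Longrightarrow> b < c \<Longrightarrow> c < n \<Longrightarrow> h a b c < 2 * t"
    and "\<And>a b c d. a < b \<Longrightarrow> b < c \<Longrightarrow> c < d \<Longrightarrow> d < n \<Longrightarrow> h a b c \<noteq> h b c d"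
proof -
  obtain p :: "nat \<Rightarrow> nat \<Rightarrow> nat" where p: "\<And>a b. a < b \<Longrightarrow> b < n \<Longrightarrow> p a b < 2 ^ t"
      "\<And>a b c. a < b \<Longrightarrow> b < c \<Longrightarrow> c < n \<Longrightarrow> p a b \<noteq> p b c"
    using shift_pairs_coloring[OF assms] by metis
  have "\<exists>i<t. bit (p a b) i \<noteq> bit (p b c) i" if "a < b" "b < c" "c < n" for a b c
    using that p by (intro neq_imp_bit_differs) auto
  then obtain j where j: "\<And>a b c. a < b \<Longrightarrow> b < c \<Longrightarrow> c < n \<Longrightarrow>
      j a b c < t \<and> bit (p a b) (j a b c) \<noteq> bit (p b c) (j a b c)"
    by metis
  \<comment> \<open>A position where the colours of the two consecutive pairs differ, together with
    the bit of the first pair there. If \<open>h a b c = h b c d\<close>, then \<open>p a b\<close>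
    and \<open>p b c\<close> agree at the position chosen to separate them.\<close>
  define h where "h a b c = 2 * j a b c + of_bool (bit (p a b) (j a b c))" for a b c
  show ?thesis
  proof (rule that)
    fix a b c assume "a < b" "b < c" "c < n"
    then show "h a b c < 2 * t" using j[of a b c] by (auto simp: h_def)
  next
    fix a b c d assume *: "a < b" "b < c" "c < d" "d < n"
    show "h a b c \<noteq> h b c d"
    proof
      assume eq: "h a b c = h b c d"
      then have "h a b c div 2 = h b c d div 2" "h a b c mod 2 = h b c d mod 2"
        by simp_all
      then have "j a b c = j b c d" "bit (p a b) (j a b c) = bit (p b c) (j b c d)"
        by (simp_all add: h_def of_bool_def split: if_splits)
      then show False using j[of a b c] * by auto
    qed
  qed
qed

section \<open>Lower bound for colourings of shifted triples\<close>

lemma shift_triples_coloring_bound: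
  fixes h :: "nat \<Rightarrow> nat \<Rightarrow> nat \<Rightarrow> nat"
  assumes lt: "\<And>a b c. a < b \<Longrightarrow> b < c \<Longrightarrow> c < n \<Longrightarrow> h a b c < k"
    and neq: "\<And>a b c d. a < b \<Longrightarrow> b < c \<Longrightarrow> c < d \<Longrightarrow> d < n \<Longrightarrow> h a b c \<noteq> h b c d"
  shows "n \<le> 2 ^ 2 ^ k"
proof -
  \<comment> \<open>Each level trades a coordinate for a power set: \<open>h a b c\<close> lies in
    \<open>S b c\<close> but not in \<open>S a b\<close>, and then \<open>S a b\<close> lies in
    \<open>T b\<close> but not in \<open>T a\<close>.\<close>
  define S where "S a b = {h x a b | x. x < a}" for a b
  define T where "T b = {S a b | a. a < b}" for b
  have S_neq: "S a b \<noteq> S b c" if "a < b" "b < c" "c < n" for a b c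
  proof -
    have "h a b c \<in> S b c" using that by (auto simp: S_def)
    moreover have "h a b c \<notin> S a b" using that neq by (fastforce simp: S_def)
    ultimately show ?thesis by auto
  qed
  have T_neq: "T a \<noteq> T b" if "a < b" "b < n" for a b
  proof -
    have "S a b \<in> T b" using that by (auto simp: T_def)
    moreover have "S a b \<notin> T a" using that S_neq by (fastforce simp: T_def)
    ultimately show ?thesis by auto
  qed
  have "inj_on T {..<n}"
    by (intro inj_onI) (metis T_neq lessThan_iff linorder_neqE_nat)
  moreover have "T ` {..<n} \<subseteq> Pow (Pow {..<k})"
    using lt by (fastforce simp: T_def S_def)
  ultimately have "card {..<n} \<le> card (Pow (Pow {..<k}))"
    by (intro card_inj_on_le) auto
  then show ?thesis by (simp add: card_Pow)
qed

section \<open>Scalar products and supports of size three\<close>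

lemma scalar_prod_three:
  fixes u v :: "'a :: semiring_0 vec"
  assumes "dim_vec v = n" "a < b" "b < c" "c < n"
    and "\<And>i. i < n \<Longrightarrow> i \<notin> {a, b, c} \<Longrightarrow> u $ i = 0"
  shows "u \<bullet> v = u $ a * v $ a + u $ b * v $ b + u $ c * v $ c"
proof -
  have "u \<bullet> v = (\<Sum>i \<in> {a, b, c}. u $ i * v $ i)"
    unfolding scalar_prod_def assms(1) using assms by (intro sum.mono_neutral_right) auto
  then show ?thesis using assms by (simp add: add.assoc)
qed

lemma card_3_sortedE:
  fixes A :: "'a :: linorder set"
  assumes "card A = 3"
  obtains a b c where "a < b" "b < c" "A = {a, b, c}"
proof -
  have fin: "finite A" using assms card.infinite by fastforce
  have "length (sorted_list_of_set A) = Suc (Suc (Suc 0))" using assms by simp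
  then obtain a b c where xs: "sorted_list_of_set A = [a, b, c]"
    by (metis length_0_conv length_Suc_conv)
  have "sorted_wrt (<) (sorted_list_of_set A)" by simp
  then have "a < b" "b < c" by (simp_all add: xs)
  moreover have "A = {a, b, c}"
    using set_sorted_list_of_set[OF fin] by (simp add: xs)
  ultimately show ?thesis using that by blast
qed

section \<open>The shift graph inside \<open>J_pm n 3 (-2)\<close>\<close>

definition alternating_triple :: "nat \<Rightarrow> nat \<Rightarrow> nat \<Rightarrow> nat \<Rightarrow> int vec" where
  "alternating_triple n a b c = vec n (\<lambda>i. if i = a \<or> i = c then 1 else if i = b then -1 else 0)"

lemma alternating_triple_in_J_pm_verts:
  assumes "a < b" "b < c" "c < n"
  shows "alternating_triple n a b c \<in> J_pm_verts n 3"
proof -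
  have "{i. i < n \<and> alternating_triple n a b c $ i \<noteq> 0} = {a, b, c}"
    using assms by (auto simp: alternating_triple_def split: if_splits)
  then show ?thesis using assms by (auto simp: J_pm_verts_def alternating_triple_def)
qed

text \<open>At \<open>b\<close> and \<open>c\<close> the signs are -, + in the first vector and +, -
  in the second, so each shared point contributes -1.\<close>

lemma alternating_triple_shift_adjacent:
  assumes "a < b" "b < c" "c < d" "d < n"
  shows "(alternating_triple n a b c, alternating_triple n b c d) \<in> parcs (J_pm n 3 (-2))"
proof -
  have "alternating_triple n a b c \<bullet> alternating_triple n b c d = -2"
    using assms by (subst scalar_prod_three[of _ n a b c]) (auto simp: alternating_triple_def)
  then show ?thesis using assms by (auto simp: J_pm_def intro: alternating_triple_in_J_pm_verts)
qed

lemma J_pm_coloring_lower_bound: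
  assumes "proper_coloring (J_pm n 3 (-2)) k f"
  shows "n \<le> 2 ^ 2 ^ k"
proof (rule shift_triples_coloring_bound)
  fix a b c assume "a < b" "b < c" "c < n"
  then show "f (alternating_triple n a b c) < k"
    using assms alternating_triple_in_J_pm_verts[of a b c n]
    by (auto simp: proper_coloring_def J_pm_def)
next
  fix a b c d assume "a < b" "b < c" "c < d" "d < n"
  then show "f (alternating_triple n a b c) \<noteq> f (alternating_triple n b c d)"
    using assms alternating_triple_shift_adjacent[of a b c d n]
    by (auto simp: proper_coloring_def)
qed

section \<open>Upper bound from sign patterns\<close>

text \<open>Vertices with three equal signs may share a colour with those whose minority coordinate comes first.\<close>

definition sign_color :: "nat \<Rightarrow> nat \<Rightarrow> int \<Rightarrow> int \<Rightarrow> int \<Rightarrow> nat" where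
  "sign_color t h p q r =
     (if q = r then 0 else if p = q then 1 else h + 2) + (if p + q + r > 0 then 0 else 2 * t + 2)"

lemma sign_color_less:
  "h < 2 * t \<Longrightarrow> sign_color t h p q r < 2 * (2 * t + 2)"
  by (simp add: sign_color_def)

text \<open>The nine conclusions are the order-preserving ways to match two of three sorted
  positions with two of three. With equal colours, a match of opposite signs must send each minority
  coordinate to a majority one. Order excludes this if both minorities are first or both last; if
  both are in the middle, only the two shifts remain, and there the colours determine
  \<open>h\<close>.\<close>

lemma sign_color_eq_opposite_signs:
  fixes p q r p' q' r' :: int
  assumes "sign_color t h p q r = sign_color t h' p' q' r'" "h < 2 * t" "h' < 2 * t"
    and "p \<in> {-1, 1}" "q \<in> {-1, 1}" "r \<in> {-1, 1}"
    and "p' \<in> {-1, 1}" "q' \<in> {-1, 1}" "r' \<in> {-1, 1}"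
  shows "\<not> (p' = - p \<and> q' = - q)" "\<not> (p' = - p \<and> r' = - q)"
    "\<not> (p' = - p \<and> q' = - r)" "\<not> (p' = - p \<and> r' = - r)" "\<not> (q' = - p \<and> r' = - r)"
    "\<not> (p' = - q \<and> r' = - r)" "\<not> (q' = - q \<and> r' = - r)"
    "p' = - q \<and> q' = - r \<Longrightarrow> h = h'" "q' = - p \<and> r' = - q \<Longrightarrow> h = h'"
  using assms unfolding sign_color_def by (elim insertE emptyE; simp)+

lemma J_pm_proper_coloring:
  assumes "n \<le> 2 ^ 2 ^ t"
  shows "\<exists>f. proper_coloring (J_pm n 3 (-2)) (2 * (2 * t + 2)) f"
proof -
  obtain h where h: "\<And>a b c. a < b \<Longrightarrow> b < c \<Longrightarrow> c < n \<Longrightarrow> h a b c < 2 * t"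
      and h_neq: "\<And>a b c d. a < b \<Longrightarrow> b < c \<Longrightarrow> c < d \<Longrightarrow> d < n \<Longrightarrow> h a b c \<noteq> h b c d"
    using shift_triples_coloring[OF assms] by metis
  define sorted_supp where "sorted_supp v a b c \<longleftrightarrow>
    a < b \<and> b < c \<and> {i. i < n \<and> v $ i \<noteq> 0} = {a, b, c}" for v :: "int vec" and a b c
  have "\<exists>a b c. sorted_supp v a b c" if "v \<in> J_pm_verts n 3" for v
  proof -
    have "card {i. i < n \<and> v $ i \<noteq> 0} = 3" using that by (simp add: J_pm_verts_def)
    then show ?thesis unfolding sorted_supp_def by (rule card_3_sortedE) blast
  qed
  then obtain A B C where ABC: "\<And>v. v \<in> J_pm_verts n 3 \<Longrightarrow> sorted_supp v (A v) (B v) (C v)"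
    by metis
  define f where "f v = sign_color t (h (A v) (B v) (C v)) (v $ A v) (v $ B v) (v $ C v)" for v
  have vert: "A v < B v" "B v < C v" "C v < n" "dim_vec v = n"
      "\<And>i. i < n \<Longrightarrow> i \<notin> {A v, B v, C v} \<Longrightarrow> v $ i = 0"
      "v $ A v \<in> {-1, 1}" "v $ B v \<in> {-1, 1}" "v $ C v \<in> {-1, 1}"
    if v: "v \<in> J_pm_verts n 3" for v
  proof -
    have lt: "A v < B v" "B v < C v" and supp: "{i. i < n \<and> v $ i \<noteq> 0} = {A v, B v, C v}"
      using ABC[OF v] by (simp_all add: sorted_supp_def)
    have vals: "\<And>i. i < n \<Longrightarrow> v $ i \<in> {-1, 0, 1}" and dim: "dim_vec v = n"
      using v by (auto simp: J_pm_verts_def)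
    have nz: "i < n \<and> v $ i \<noteq> 0 \<longleftrightarrow> i \<in> {A v, B v, C v}" for i
      using supp by blast
    show "A v < B v" "B v < C v" "dim_vec v = n" by (fact lt dim)+
    show "C v < n" using nz by blast
    show "\<And>i. i < n \<Longrightarrow> i \<notin> {A v, B v, C v} \<Longrightarrow> v $ i = 0" using nz by blast
    show "v $ A v \<in> {-1, 1}" "v $ B v \<in> {-1, 1}" "v $ C v \<in> {-1, 1}"
      using nz[of "A v"] nz[of "B v"] nz[of "C v"] vals[of "A v"] vals[of "B v"] vals[of "C v"]
      by auto
  qed
  have "f u \<noteq> f v" if u: "u \<in> J_pm_verts n 3" and v: "v \<in> J_pm_verts n 3" and uv: "u \<bullet> v = -2"
    for u v
  proof
    assume eq: "f u = f v"
    note U = vert[OF u] and V = vert[OF v]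
    note D = sign_color_eq_opposite_signs[OF eq[unfolded f_def] h[OF U(1-3)] h[OF V(1-3)] U(6-8) V(6-8)]
    define x y z where "x = v $ A u" and "y = v $ B u" and "z = v $ C u"
    note xyz_def = this
    have xyz: "x \<in> {-1, 0, 1}" "y \<in> {-1, 0, 1}" "z \<in> {-1, 0, 1}"
      using v U(1-3) by (auto simp: J_pm_verts_def xyz_def)
    have v_in: "i = A v \<or> i = B v \<or> i = C v" if "i < n" "v $ i \<noteq> 0" for i
      using V(5)[OF that(1)] that(2) by auto
    have prod: "p * w \<in> {-1, 0, 1} \<and> (p * w = -1 \<longleftrightarrow> w = - p)"
      if "p \<in> {-1, 1}" "w \<in> {-1, 0, 1}" for p w :: int
      using that by auto
    have "u $ A u * x + u $ B u * y + u $ C u * z = -2"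
      using scalar_prod_three[OF V(4) U(1-3,5)] uv by (simp add: xyz_def)
    \<comment> \<open>Three terms from {-1, 0, 1} sum to -2 only as -1, -1, 0 in some order.\<close>
    then consider
        (BC) "y = - (u $ B u)" "z = - (u $ C u)"
      | (AC) "x = - (u $ A u)" "z = - (u $ C u)"
      | (AB) "x = - (u $ A u)" "y = - (u $ B u)"
      using prod[OF U(6) xyz(1)] prod[OF U(7) xyz(2)] prod[OF U(8) xyz(3)]
      by (elim conjE insertE emptyE) simp_all
    then show False
    proof cases
      case BC
      have "B u = A v \<or> B u = B v \<or> B u = C v" "C u = A v \<or> C u = B v \<or> C u = C v"
        by (rule v_in; use BC U in \<open>force simp: xyz_def\<close>)+
      \<comment> \<open>Both supports are sorted, so only increasing matches survive. The first one
        is a shift, refuted by \<open>h_neq\<close>; the others contradict \<open>D\<close>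
        directly.\<close>
      then consider "B u = A v" "C u = B v" | "B u = A v" "C u = C v" | "B u = B v" "C u = C v"
        using U(2) V(1,2) by linarith
      then show False
        using BC D h_neq[of "A u" "B u" "C u" "C v"] U(1-3) V(1-3)
        by cases (simp_all add: xyz_def)
    next
      case AC
      have "A u = A v \<or> A u = B v \<or> A u = C v" "C u = A v \<or> C u = B v \<or> C u = C v"
        by (rule v_in; use AC U in \<open>force simp: xyz_def\<close>)+
      \<comment> \<open>No shift arises here, since the outer points of \<open>u\<close> are not
        consecutive in its support.\<close>
      then consider "A u = A v" "C u = B v" | "A u = A v" "C u = C v" | "A u = B v" "C u = C v"
        using U(1,2) V(1,2) by linarith
      then show False
        using AC D by cases (simp_all add: xyz_def)
    next
      case AB
      have "A u = A v \<or> A u = B v \<or> A u = C v" "B u = A v \<or> B u = B v \<or> B u = C v"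
        by (rule v_in; use AB U in \<open>force simp: xyz_def\<close>)+
      then consider "A u = A v" "B u = B v" | "A u = A v" "B u = C v" | "A u = B v" "B u = C v"
        using U(1) V(1,2) by linarith
      then show False
        using AB D h_neq[of "A v" "A u" "B u" "C u"] U(1-3) V(1-3)
        by cases (simp_all add: xyz_def)
    qed
  qed
  moreover have "f v < 2 * (2 * t + 2)" if "v \<in> J_pm_verts n 3" for v
    unfolding f_def using vert[OF that] by (intro sign_color_less h)
  ultimately have "proper_coloring (J_pm n 3 (-2)) (2 * (2 * t + 2)) f"
    by (auto simp: proper_coloring_def J_pm_def)
  then show ?thesis by blast
qed

section \<open>Iterated logarithms and the final bounds\<close>

text \<open>Both ceilings drop out because they are compared with the integers \<open>k\<close> and
  \<open>2 ^ k\<close>; \<open>n \<ge> 2\<close> keeps the argument of the outer logarithm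
  positive.\<close>

lemma ceiling_log_log_le_iff:
  fixes n k :: nat
  assumes "n \<ge> 2"
  shows "\<lceil>log 2 \<lceil>log 2 (real n)\<rceil>\<rceil> \<le> int k \<longleftrightarrow> n \<le> 2 ^ 2 ^ k"
proof -
  have "log 2 (real n) > 0" using assms by simp
  then have pos: "real_of_int \<lceil>log 2 (real n)\<rceil> > 0" by linarith
  have "\<lceil>log 2 \<lceil>log 2 (real n)\<rceil>\<rceil> \<le> int k \<longleftrightarrow> log 2 \<lceil>log 2 (real n)\<rceil> \<le> real k"
    by (simp add: ceiling_le_iff)
  also have "\<dots> \<longleftrightarrow> real_of_int \<lceil>log 2 (real n)\<rceil> \<le> real_of_int (2 ^ k)"
    using pos by (simp add: log_le_iff powr_realpow)
  also have "\<dots> \<longleftrightarrow> log 2 (real n) \<le> real (2 ^ k)"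
    unfolding of_int_le_iff ceiling_le_iff by simp
  also have "\<dots> \<longleftrightarrow> real n \<le> 2 powr real (2 ^ k)"
    using assms by (simp add: log_le_iff)
  also have "\<dots> \<longleftrightarrow> real n \<le> real (2 ^ 2 ^ k)"
    by (subst powr_realpow) simp_all
  finally show ?thesis by (simp only: of_nat_le_iff)
qed

theorem theorem3:
  fixes n :: nat
  assumes "n \<ge> 3"
  shows "\<lceil>log 2 \<lceil>log 2 (real n)\<rceil>\<rceil> \<le> int (chromatic_number (J_pm n 3 (-2)))
    \<and> int (chromatic_number (J_pm n 3 (-2))) \<le> 4 * \<lceil>log 2 \<lceil>log 2 (real n)\<rceil>\<rceil> + 6"
proof
  have "pair_graph (J_pm n 3 (-2))" by (rule pair_graph_J_pm) simp
  then obtain f where "proper_coloring (J_pm n 3 (-2)) (chromatic_number (J_pm n 3 (-2))) f"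
    using chromatic_number_coloring by blast
  then show "\<lceil>log 2 \<lceil>log 2 (real n)\<rceil>\<rceil> \<le> int (chromatic_number (J_pm n 3 (-2)))"
    using J_pm_coloring_lower_bound ceiling_log_log_le_iff assms by simp
next
  define t where "t = nat \<lceil>log 2 \<lceil>log 2 (real n)\<rceil>\<rceil>"
  \<comment> \<open>The iterated logarithm is nonnegative, so \<open>nat\<close> in \<open>t\<close>
    does not truncate.\<close>
  have "log 2 (real n) > 0" using assms by simp
  then have "\<lceil>log 2 (real n)\<rceil> \<ge> 1" by linarith
  then have "log 2 \<lceil>log 2 (real n)\<rceil> \<ge> 0" by simp
  then have t: "int t = \<lceil>log 2 \<lceil>log 2 (real n)\<rceil>\<rceil>" by (simp add: t_def)
  then have "n \<le> 2 ^ 2 ^ t" using ceiling_log_log_le_iff[of n t] assms by simp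
  then have "chromatic_number (J_pm n 3 (-2)) \<le> 2 * (2 * t + 2)"
    unfolding chromatic_number_def by (intro Least_le J_pm_proper_coloring)
  \<comment> \<open>The colouring has \<open>4 * t + 4\<close> colours, two fewer than
    claimed.\<close>
  then show "int (chromatic_number (J_pm n 3 (-2))) \<le> 4 * \<lceil>log 2 \<lceil>log 2 (real n)\<rceil>\<rceil> + 6"
    unfolding t[symmetric] of_nat_le_iff[where 'a = int, symmetric] by simp
qed

end
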